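(* Let $(H;\langle\cdot,\cdot\rangle)$ be an inner product space over $\mathbb{K}$, $x,y\in H$ and $M>m>0$ real numbers such that either $$\operatorname{Re}\langle My-x,\,x-my\rangle\ge 0,$$ or, equivalently, $$\left\|x-\frac{M+m}{2}y\right\|\le\frac12(M-m)\|y\|$$ holds. Then $$0\le \|x\|+\|y\|-\|x+y\|\le \frac{\sqrt2}{2}\cdot\frac{M-m}{\sqrt{M+m}}\,\|y\| .$$
   Context: $\mathbb{K}$ denotes $\mathbb{R}$ or $\mathbb{C}$. Inner products are linear in the first argument and conjugate-linear in the second, and $\|x\|=\langle x,x\rangle^{1/2}$. *)

theory Defs
  imports "HOL-Analysis.Inner_Product"
begin

text \<open>
  The scalar field: a field identified, through an injective homomorphism of real
  algebras into the complex numbers, with exactly the real numbers or exactly the complex numbers.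
\<close>

class real_or_complex = real_field +
  fixes to_complex :: "'a \<Rightarrow> complex"
    and conjugate :: "'a \<Rightarrow> 'a"
  assumes to_complex_add: "to_complex (a + b) = to_complex a + to_complex b"
    and to_complex_mult: "to_complex (a * b) = to_complex a * to_complex b"
    and to_complex_scaleR: "to_complex (r *\<^sub>R a) = r *\<^sub>R to_complex a"
    and inj_to_complex: "inj to_complex"
    and range_to_complex: "range to_complex = \<real> \<or> range to_complex = UNIV"
    and to_complex_conjugate: "to_complex (conjugate a) = cnj (to_complex a)"

instantiation real :: real_or_complex
begin

definition to_complex_real :: "real \<Rightarrow> complex"
  where "to_complex_real r = complex_of_real r"

definition conjugate_real :: "real \<Rightarrow> real"
  where "conjugate_real r = r"

instance
proof
  show "inj (to_complex :: real \<Rightarrow> complex)"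
    by (simp add: inj_def to_complex_real_def)
  show "range (to_complex :: real \<Rightarrow> complex) = \<real> \<or> range (to_complex :: real \<Rightarrow> complex) = UNIV"
    by (simp add: Reals_def to_complex_real_def)
qed (simp_all add: to_complex_real_def conjugate_real_def scaleR_conv_of_real)

end

instantiation complex :: real_or_complex
begin

definition to_complex_complex :: "complex \<Rightarrow> complex"
  where "to_complex_complex z = z"

definition conjugate_complex :: "complex \<Rightarrow> complex"
  where "conjugate_complex z = cnj z"

instance
  by standard (simp_all add: to_complex_complex_def conjugate_complex_def inj_def)

end

definition re :: "'k::real_or_complex \<Rightarrow> real"
  where "re a = Re (to_complex a)"

text \<open>
  By conjugate symmetry the scalar \<open>ip x x\<close> is real, so positivity is stated for its real part.
\<close>

locale inner_product_space = vector_space scale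
  for scale :: "'k::real_or_complex \<Rightarrow> 'h::ab_group_add \<Rightarrow> 'h" +
  fixes ip :: "'h \<Rightarrow> 'h \<Rightarrow> 'k"
  assumes ip_add_left: "ip (x + y) z = ip x z + ip y z"
    and ip_scale_left: "ip (scale a x) y = a * ip x y"
    and ip_conjugate_sym: "ip y x = conjugate (ip x y)"
    and ip_nonneg: "0 \<le> re (ip x x)"
    and ip_eq_zero: "ip x x = 0 \<Longrightarrow> x = 0"

definition ip_norm :: "('h \<Rightarrow> 'h \<Rightarrow> 'k::real_or_complex) \<Rightarrow> 'h \<Rightarrow> real"
  where "ip_norm ip x = sqrt (re (ip x x))"

lemma inner_product_space_real_inner:
  "inner_product_space scaleR (inner :: 'a::real_inner \<Rightarrow> 'a \<Rightarrow> real)"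
proof
  fix x y z :: 'a and a :: real
  show "inner (x + y) z = inner x z + inner y z" by (rule inner_add_left)
  show "inner (a *\<^sub>R x) y = a * inner x y" by simp
  show "inner y x = conjugate (inner x y)" by (simp add: conjugate_real_def inner_commute)
  show "0 \<le> re (inner x x)" by (simp add: re_def to_complex_real_def)
  show "x = 0" if "inner x x = 0" using that by simp
qed

lemma ip_norm_inner: "ip_norm (inner :: 'a::real_inner \<Rightarrow> 'a \<Rightarrow> real) = norm"
  by (simp add: fun_eq_iff ip_norm_def re_def to_complex_real_def norm_eq_sqrt_inner)

lemma inner_product_space_complex:
  "inner_product_space (*) (\<lambda>x y :: complex. x * cnj y)"
proof
  fix x y z a b :: complex
  show "a * (x + y) = a * x + a * y" by (rule distrib_left)
  show "(a + b) * x = a * x + b * x" by (rule distrib_right)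
  show "a * (b * x) = a * b * x" by simp
  show "1 * x = x" by simp
  show "(x + y) * cnj z = x * cnj z + y * cnj z" by (rule distrib_right)
  show "a * x * cnj y = a * (x * cnj y)" by simp
  show "y * cnj x = conjugate (x * cnj y)" by (simp add: conjugate_complex_def)
  show "0 \<le> re (x * cnj x)" by (simp add: re_def to_complex_complex_def)
  show "x = 0" if "x * cnj x = 0" using that by simp
qed

end

theory Submission
  imports Defs
begin

text \<open>
  Squaring reduces the bound to \<open>\<parallel>x\<parallel>\<parallel>y\<parallel> - Re\<langle>x,y\<rangle> \<le> (M - m)\<^sup>2 / (4(M + m)) \<parallel>y\<parallel>\<^sup>2\<close>.
  Both hypotheses expand to \<open>\<parallel>x\<parallel>\<^sup>2 + mM\<parallel>y\<parallel>\<^sup>2 \<le> (M + m) Re\<langle>x,y\<rangle>\<close>, and then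
  the gap in this inequality is at least \<open>(\<parallel>x\<parallel> - (M + m)/2 \<parallel>y\<parallel>)\<^sup>2 / (M + m)\<close>.
\<close>

lemma re_add: "re (a + b) = re a + re b"
  by (simp add: re_def to_complex_add)

lemma re_of_real_mult: "re (of_real t * a) = t * re a"
  by (simp add: re_def to_complex_scaleR flip: scaleR_conv_of_real)

lemma re_conjugate: "re (conjugate a) = re a"
  by (simp add: re_def to_complex_conjugate)

lemma nonneg_quadratic_discriminant:
  fixes a b c :: real
  assumes "0 \<le> c" and nonneg: "\<And>t. 0 \<le> a + 2 * t * b + t\<^sup>2 * c"
  shows "b\<^sup>2 \<le> a * c"
proof (cases "c = 0")
  case True
  have "b = 0"
  proof (rule ccontr)
    assume "b \<noteq> 0"
    \<comment> \<open>With \<open>c = 0\<close> the polynomial is affine; at this argument it takes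
      the value -1.\<close>
    then have "2 * (- (a + 1) / (2 * b)) * b = - (a + 1)" by simp
    then show False
      using nonneg[of "- (a + 1) / (2 * b)"] True by simp
  qed
  then show ?thesis using True by simp
next
  case False
  with \<open>0 \<le> c\<close> have "c > 0" by simp
  have "a + 2 * (- b / c) * b + (- b / c)\<^sup>2 * c = a - b\<^sup>2 / c"
    using False by (simp add: field_simps power2_eq_square)
  then have "b\<^sup>2 / c \<le> a"
    using nonneg[of "- b / c"] by linarith
  then show ?thesis using \<open>c > 0\<close> by (simp add: pos_divide_le_eq)
qed

context inner_product_space
begin

lemma re_ip_commute: "re (ip u v) = re (ip v u)"
  by (metis ip_conjugate_sym re_conjugate)

lemma re_ip_add_left: "re (ip (u + v) w) = re (ip u w) + re (ip v w)"
  by (simp add: ip_add_left re_add)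

lemma re_ip_add_right: "re (ip w (u + v)) = re (ip w u) + re (ip w v)"
  by (metis re_ip_add_left re_ip_commute)

lemma re_ip_diff_left: "re (ip (u - v) w) = re (ip u w) - re (ip v w)"
  using re_ip_add_left[of "u - v" v w] by simp

lemma re_ip_diff_right: "re (ip w (u - v)) = re (ip w u) - re (ip w v)"
  by (metis re_ip_diff_left re_ip_commute)

lemma re_ip_scale_left: "re (ip (scale (of_real t) u) v) = t * re (ip u v)"
  by (simp only: ip_scale_left re_of_real_mult)

lemma re_ip_scale_right: "re (ip v (scale (of_real t) u)) = t * re (ip v u)"
  by (metis re_ip_scale_left re_ip_commute)

text \<open>The map \<open>re (ip _ _)\<close> is a symmetric bilinear form over the reals, so the
  expansions below treat the real and complex fields alike.\<close>

lemmas re_ip_bilinear =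
  re_ip_add_left re_ip_add_right re_ip_diff_left re_ip_diff_right
  re_ip_scale_left re_ip_scale_right

lemma ip_norm_nonneg: "0 \<le> ip_norm ip u"
  by (simp add: ip_norm_def ip_nonneg)

lemma ip_norm_power2: "(ip_norm ip u)\<^sup>2 = re (ip u u)"
  by (simp add: ip_norm_def ip_nonneg)

lemma ip_norm_add_power2:
  "(ip_norm ip (u + v))\<^sup>2 = (ip_norm ip u)\<^sup>2 + 2 * re (ip u v) + (ip_norm ip v)\<^sup>2"
  by (simp add: ip_norm_power2 re_ip_bilinear re_ip_commute[of v u])

text \<open>Cauchy-Schwarz for the real part: the squared norm of u + t v is a nonnegative quadratic
  in the real variable t.\<close>

lemma re_ip_le_norm_mult: "re (ip u v) \<le> ip_norm ip u * ip_norm ip v"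
proof -
  have "0 \<le> re (ip u u) + 2 * t * re (ip u v) + t\<^sup>2 * re (ip v v)" for t
    using ip_nonneg[of "u + scale (of_real t) v"]
    by (simp add: re_ip_bilinear re_ip_commute[of v u] power2_eq_square algebra_simps)
  then have "(re (ip u v))\<^sup>2 \<le> re (ip u u) * re (ip v v)"
    by (rule nonneg_quadratic_discriminant[OF ip_nonneg])
  then have "(re (ip u v))\<^sup>2 \<le> (ip_norm ip u * ip_norm ip v)\<^sup>2"
    by (simp add: ip_norm_power2 power_mult_distrib)
  then show ?thesis
    by (rule power2_le_imp_le) (simp add: ip_norm_nonneg)
qed

lemma ip_norm_triangle: "ip_norm ip (u + v) \<le> ip_norm ip u + ip_norm ip v"
proof (rule power2_le_imp_le)
  show "(ip_norm ip (u + v))\<^sup>2 \<le> (ip_norm ip u + ip_norm ip v)\<^sup>2"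
    using re_ip_le_norm_mult[of u v] by (simp add: ip_norm_add_power2 power2_sum)
qed (simp add: ip_norm_nonneg)

lemma re_ip_between_eq:
  "re (ip (scale (of_real M) y - x) (x - scale (of_real m) y))
    = (M + m) * re (ip x y) - (ip_norm ip x)\<^sup>2 - m * M * (ip_norm ip y)\<^sup>2"
  by (simp add: ip_norm_power2 re_ip_bilinear re_ip_commute[of y x] algebra_simps)

text \<open>With p = (M - m)/2 y and q = x - (M + m)/2 y, the two factors are p - q and p + q, and
  the real part of their product is the difference of the squared norms of p and q.\<close>

lemma ip_norm_midpoint_power2:
  "(ip_norm ip (x - scale (of_real ((M + m) / 2)) y))\<^sup>2
    = (1 / 2 * (M - m) * ip_norm ip y)\<^sup>2
      - re (ip (scale (of_real M) y - x) (x - scale (of_real m) y))"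
proof -
  have "(ip_norm ip (x - scale (of_real ((M + m) / 2)) y))\<^sup>2
      = (ip_norm ip x)\<^sup>2 - (M + m) * re (ip x y) + ((M + m) / 2)\<^sup>2 * (ip_norm ip y)\<^sup>2"
    unfolding ip_norm_power2 re_ip_bilinear re_ip_commute[of y x]
    by (simp add: power2_eq_square field_simps)
  then show ?thesis
    unfolding re_ip_between_eq by (simp add: power2_eq_square field_simps)
qed

text \<open>Since \<open>m \<le> M\<close>, both sides of the norm inequality are nonnegative, so it
  may be squared and compared with the midpoint identity.\<close>

lemma re_ip_between_nonneg_iff:
  assumes "m \<le> M"
  shows "0 \<le> re (ip (scale (of_real M) y - x) (x - scale (of_real m) y)) \<longleftrightarrow>
    ip_norm ip (x - scale (of_real ((M + m) / 2)) y) \<le> 1 / 2 * (M - m) * ip_norm ip y"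
    (is "0 \<le> ?r \<longleftrightarrow> ?n \<le> ?b")
proof -
  have "0 \<le> ?b" using assms by (simp add: ip_norm_nonneg)
  then have "?n \<le> ?b \<longleftrightarrow> ?n\<^sup>2 \<le> ?b\<^sup>2"
    by (simp only: power_mono_iff[OF ip_norm_nonneg, of _ 2] zero_less_numeral)
  then show ?thesis using ip_norm_midpoint_power2[of x M m y] by linarith
qed

lemma ip_norm_triangle_reverse:
  assumes "0 < M + m" and "m \<le> M"
    and between: "0 \<le> re (ip (scale (of_real M) y - x) (x - scale (of_real m) y))"
  shows "ip_norm ip x + ip_norm ip y - ip_norm ip (x + y)
    \<le> sqrt 2 / 2 * ((M - m) / sqrt (M + m)) * ip_norm ip y"
proof -
  define a b n r k
    where "a = ip_norm ip x" and "b = ip_norm ip y" and "n = ip_norm ip (x + y)"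
      and "r = re (ip x y)" and "k = sqrt 2 / 2 * ((M - m) / sqrt (M + m)) * b"
  have "0 \<le> b" "0 \<le> n" by (simp_all add: b_def n_def ip_norm_nonneg)
  then have "0 \<le> k" using assms by (simp add: k_def)
  \<comment> \<open>Squaring the claimed bound removes both roots; the factor \<open>M + m\<close>
    then clears the denominator.\<close>
  have "k\<^sup>2 = (sqrt 2 / 2)\<^sup>2 * ((M - m)\<^sup>2 / (sqrt (M + m))\<^sup>2) * b\<^sup>2"
    by (simp only: k_def power_mult_distrib power_divide)
  also have "\<dots> = 1 / 2 * ((M - m)\<^sup>2 / (M + m)) * b\<^sup>2"
    using assms by (simp add: power_divide)
  finally have "k\<^sup>2 = (M - m)\<^sup>2 * b\<^sup>2 / 2 / (M + m)" by simp
  then have k: "(M + m) * k\<^sup>2 = (M - m)\<^sup>2 * b\<^sup>2 / 2"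
    using assms(1) by (metis less_irrefl mult.commute nonzero_eq_divide_eq)
  have "a\<^sup>2 + m * M * b\<^sup>2 \<le> (M + m) * r"
    using between by (simp add: re_ip_between_eq a_def b_def r_def)
  then have "2 * (M + m) * (a * b - r) \<le> 2 * ((M + m) * (a * b) - a\<^sup>2 - m * M * b\<^sup>2)"
    by (simp add: algebra_simps)
  \<comment> \<open>Completing the square in \<open>a\<close> leaves exactly
    \<open>(M + m) * k\<^sup>2\<close> as the maximum, which explains the constant in
    \<open>k\<close>.\<close>
  also have "\<dots> = (M - m)\<^sup>2 * b\<^sup>2 / 2 - 2 * (a - (M + m) / 2 * b)\<^sup>2"
    by (simp add: power2_eq_square field_simps)
  also have "\<dots> \<le> (M + m) * k\<^sup>2" by (simp add: k)
  finally have "(M + m) * (2 * (a * b - r)) \<le> (M + m) * k\<^sup>2" by (simp add: algebra_simps)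
  then have "2 * (a * b - r) \<le> k\<^sup>2" using assms by simp
  moreover have "n\<^sup>2 = a\<^sup>2 + 2 * r + b\<^sup>2"
    by (simp add: n_def a_def b_def r_def ip_norm_add_power2)
  \<comment> \<open>Here \<open>2 * (a * b - r)\<close> equals
    \<open>(a + b)\<^sup>2 - n\<^sup>2\<close>, so
    \<open>(a + b)\<^sup>2 \<le> n\<^sup>2 + k\<^sup>2\<close>; adding this cross term makes the
    right side a square.\<close>
  moreover have "0 \<le> 2 * n * k" using \<open>0 \<le> n\<close> \<open>0 \<le> k\<close> by simp
  ultimately have "(a + b)\<^sup>2 \<le> (n + k)\<^sup>2" by (simp add: power2_sum mult.assoc mult.commute[of n])
  then have "a + b \<le> n + k"
    by (rule power2_le_imp_le) (simp add: \<open>0 \<le> n\<close> \<open>0 \<le> k\<close>)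
  then show ?thesis by (simp add: a_def b_def n_def k_def)
qed

end

theorem proposition2:
  fixes scale :: "'k::real_or_complex \<Rightarrow> 'h::ab_group_add \<Rightarrow> 'h"
    and ip :: "'h \<Rightarrow> 'h \<Rightarrow> 'k"
    and x y :: 'h
    and m M :: real
  assumes "inner_product_space scale ip"
    and "0 < m" and "m < M"
  shows "(re (ip (scale (of_real M) y - x) (x - scale (of_real m) y)) \<ge> 0 \<longleftrightarrow>
            ip_norm ip (x - scale (of_real ((M + m) / 2)) y) \<le> 1 / 2 * (M - m) * ip_norm ip y)
       \<and> (re (ip (scale (of_real M) y - x) (x - scale (of_real m) y)) \<ge> 0 \<or>
            ip_norm ip (x - scale (of_real ((M + m) / 2)) y) \<le> 1 / 2 * (M - m) * ip_norm ip y
          \<longrightarrow> 0 \<le> ip_norm ip x + ip_norm ip y - ip_norm ip (x + y) \<and>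
              ip_norm ip x + ip_norm ip y - ip_norm ip (x + y)
                \<le> sqrt 2 / 2 * ((M - m) / sqrt (M + m)) * ip_norm ip y)"
proof -
  interpret inner_product_space scale ip by fact
  have "m \<le> M" and "0 < M + m" using assms(2,3) by simp_all
  note iff = re_ip_between_nonneg_iff[OF \<open>m \<le> M\<close>, of y x]
  show ?thesis
    \<comment> \<open>Rewriting the norm condition into the inner product condition makes the
      equivalence trivial and merges the two alternatives.\<close>
    unfolding iff[symmetric]
    using ip_norm_triangle[of x y] ip_norm_triangle_reverse[OF \<open>0 < M + m\<close> \<open>m \<le> M\<close>, of y x]
    by auto
qed

end
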